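(* Let $\mathcal{H}$ be a planar PPCD with starting location $q_0$ and starting continuous state $x_0\neq 0$ lying in a facet $f_0\in\bigcup_{q\in Q}\mathbb{F}(\mathrm{Inv}(q))$. Let $\mathcal{H}^{\mathrm{red}}$ be its quotient WDTMC, with all paths starting at $(q_0,f_0)$. Then (i) $\mathcal{H}$ is absolutely stable if and only if $\mathcal{H}^{\mathrm{red}}$ is absolutely convergent; and (ii) $\mathcal{H}$ is almost surely stable if and only if $\mathcal{H}^{\mathrm{red}}$ is almost surely convergent.
   Context: **WDTMC.** For a set $S$, $\mathrm{Dist}(S)$ is the set of probability distributions on $S$. A DTMC is a pair $(S,P)$ with $P:S\to\mathrm{Dist}(S)$; write $P(s,s')=P(s)(s')$. A path is a sequence of states $\sigma=\sigma_1,\sigma_2,\dots$ with $P(\sigma_i,\sigma_{i+1})>0$ for all consecutive states; an edge is a pair $(s,s')$ with $P(s,s')>0$. A weighted DTMC (WDTMC) is $(S,P,W)$ with $W$ a weight function on edges with values in $\mathbb{R}\cup\{+\infty\}$. For an infinite path, $W(\sigma)=\lim_{n\to\infty}\sum_{i=1}^n W(\sigma_i,\sigma_{i+1})$. Fix an initial state and consider only paths starting there; $\Pr$ is the usual cylinder-set probability measure on these infinite paths. The WDTMC is absolutely convergent if $W(\sigma)=-\infty$ for every infinite path $\sigma$ from the initial state, and almost surely convergent if $\Pr\{\sigma : W(\sigma)=-\infty\}=1$. **PPCD.** A polyhedral subset of $\mathbb{R}^n$ means a closed convex polyhedron. For a polyhedral set $A$, $\partial(A)$ is its boundary and $\mathbb{F}(A)$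 is the set of its facets (the largest polyhedral subsets of $\partial(A)$). $A$ is positive scaling invariant if $x\in A,\ \alpha>0$ imply $\alpha x\in A$. A Probabilistic Piecewise Constant Derivative System (PPCD) is $\mathcal{H}=(Q,\mathcal{X},\mathrm{Inv},\mathrm{Flow},\mathrm{Edges})$ where $Q$ is a finite set of locations, $\mathcal{X}=\mathbb{R}^n$, $\mathrm{Inv}$ assigns to each $q\in Q$ a positive scaling invariant polyhedral subset of $\mathcal{X}$, $\mathrm{Flow}:Q\to\mathcal{X}$, and $\mathrm{Edges}\subseteq Q\times\bigcup_{q}\mathbb{F}(\mathrm{Inv}(q))\times\mathrm{Dist}(Q)$ is such that $(q,f,\rho)\in\mathrm{Edges}$ implies $f\in\mathbb{F}(\mathrm{Inv}(q))$, and for each $(q,f)$ there is at most one $\rho$ with $(q,f,\rho)\in\mathrm{Edges}$. It is planar if $\mathcal{X}=\mathbb{R}^2$; in this case the facets of each $\mathrm{Inv}(q)$ are rays emanating from the origin. **Semantics.** There is a continuous transition from $x_1$ to $x_2$ with respect to $q$ if $x_1,x_2\in\mathrm{Inv}(q)$ and there is $T>0$ with $x_2=x_1+T\,\mathrm{Flow}(q)\in\partial(\mathrm{Inv}(q))$ and $x_1+t\,\mathrm{Flow}(q)\notin\partial(\mathrm{Inv}(q))$ for $0<t<T$. The point $x_1$ has an infinite edge with respect to $q$ if $x_1+t\,\mathrm{Flow}(q)\in\mathrm{Inv}(q)$ for all $t\ge 0$. There is a discrete transition from $q_1$ to $q_2$ with probability $p$ via $\rho$ and $f\in\mathbb{F}(\mathrm{Inv}(q_1))$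 if $f\subseteq\mathrm{Inv}(q_2)$, $(q_1,f,\rho)\in\mathrm{Edges}$ and $p=\rho(q_2)$. The semantics is the WDTMC $\mathcal{M}_{\mathcal{H}}=(Q\times\mathcal{X},P_{\mathcal{H}},W_{\mathcal{H}})$ where: - if there is a continuous transition from $x_1$ to $x_2$ with respect to $q_1$, and a discrete transition from $q_1$ to $q_2$ with probability $p$ via some $\rho$ and $f$ with $x_2\in f$, then $P_{\mathcal{H}}((q_1,x_1),(q_2,x_2))=p$ and $W_{\mathcal{H}}((q_1,x_1),(q_2,x_2))=\log(\|x_2\|_\infty/\|x_1\|_\infty)$; - if $x_1$ has an infinite edge with respect to $q_1$, then $P_{\mathcal{H}}((q_1,x_1),(q_1,x_1))=1$, all other probabilities out of $(q_1,x_1)$ are $0$, and $W_{\mathcal{H}}((q_1,x_1),(q_1,x_1))=+\infty$; - otherwise $P_{\mathcal{H}}$ and $W_{\mathcal{H}}$ are $0$. Standing assumptions: all paths of $\mathcal{M}_{\mathcal{H}}$ start at a fixed $(q_0,x_0)$; the rules above define a WDTMC on the states reachable from $(q_0,x_0)$ (outgoing probabilities well defined and summing to $1$); the continuous component of every reachable state is nonzero. **Stability.** A path $(q_0,x_0),(q_1,x_1),\dots$ converges to $0$ if $\|x_i\|_\infty\to 0$. $\mathcal{H}$ is absolutely stable if every infinite path of $\mathcal{M}_{\mathcal{H}}$ (from $(q_0,x_0)$) converges to $0$, and almost surely stable if the set of infinite paths of $\mathcal{M}_{\mathcal{H}}$ converging to $0$ has probability $1$. **Quotient.** For planar $\mathcal{H}$,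 $\mathcal{H}^{\mathrm{red}}=(S^{\mathrm{red}},P^{\mathrm{red}},W^{\mathrm{red}})$ with $S^{\mathrm{red}}=Q\times\bigcup_{q\in Q}\mathbb{F}(\mathrm{Inv}(q))$; if there exist (nonzero) $x_1\in f_1$, $x_2\in f_2$ with $P_{\mathcal{H}}((q_1,x_1),(q_2,x_2))>0$, then $P^{\mathrm{red}}((q_1,f_1),(q_2,f_2))=P_{\mathcal{H}}((q_1,x_1),(q_2,x_2))$ and $W^{\mathrm{red}}((q_1,f_1),(q_2,f_2))=W_{\mathcal{H}}((q_1,x_1),(q_2,x_2))$ for any such choice (the values do not depend on the choice); otherwise both are $0$. *)

theory Defs
  imports "HOL-Probability.Probability"
begin

section \<open>Weighted discrete-time Markov chains\<close>

record 's wdtmc =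
  states :: "'s set"
  tprob :: "'s \<Rightarrow> 's \<Rightarrow> real"
  weight :: "'s \<Rightarrow> 's \<Rightarrow> ereal"

definition is_dist :: "'s set \<Rightarrow> ('s \<Rightarrow> real) \<Rightarrow> bool" where
  "is_dist S f \<longleftrightarrow> (\<exists>p. set_pmf p \<subseteq> S \<and> pmf p = f)"

definition is_edge :: "'s wdtmc \<Rightarrow> 's \<Rightarrow> 's \<Rightarrow> bool" where
  "is_edge M s s' \<longleftrightarrow> s \<in> states M \<and> s' \<in> states M \<and> 0 < tprob M s s'"

definition reachable :: "'s wdtmc \<Rightarrow> 's \<Rightarrow> 's set" where
  "reachable M s0 = {s. (is_edge M)\<^sup>*\<^sup>* s0 s}"

definition wdtmc_from :: "'s wdtmc \<Rightarrow> 's \<Rightarrow> bool" where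
  "wdtmc_from M s0 \<longleftrightarrow> s0 \<in> states M \<and>
    (\<forall>s\<in>reachable M s0. is_dist (states M) (tprob M s) \<and>
       (\<forall>s'. is_edge M s s' \<longrightarrow> weight M s s' \<noteq> -\<infinity>))"

definition inf_paths :: "'s wdtmc \<Rightarrow> 's \<Rightarrow> (nat \<Rightarrow> 's) set" where
  "inf_paths M s0 = {\<sigma>. \<sigma> 0 = s0 \<and> (\<forall>i. is_edge M (\<sigma> i) (\<sigma> (Suc i)))}"

text \<open>
  The path measure is obtained from the Ionescu-Tulcea extension theorem. Every state space carries
  the discrete \<open>\<sigma>\<close>-algebra. States whose outgoing values do not form a distribution are made
  absorbing, so that the construction is total; if \<^term>\<open>wdtmc_from M s0\<close> holds, no such state is
  reachable. The lemma \<open>emeasure_path_measure_cylinder\<close> below gives the measure of cylinder sets.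
\<close>

definition next_pmf :: "'s wdtmc \<Rightarrow> 's \<Rightarrow> 's pmf" where
  "next_pmf M s =
    (if is_dist (states M) (tprob M s) then embed_pmf (tprob M s) else return_pmf s)"

definition path_kernel :: "'s wdtmc \<Rightarrow> 's \<Rightarrow> nat \<Rightarrow> (nat \<Rightarrow> 's) \<Rightarrow> 's measure" where
  "path_kernel M s0 n \<sigma> =
    measure_pmf (case n of 0 \<Rightarrow> return_pmf s0 | Suc k \<Rightarrow> next_pmf M (\<sigma> k))"

definition path_measure :: "'s wdtmc \<Rightarrow> 's \<Rightarrow> (nat \<Rightarrow> 's) measure" where
  "path_measure M s0 =
    projective_family.lim UNIV
      (Ionescu_Tulcea.CI (path_kernel M s0) (\<lambda>_. count_space UNIV)) (\<lambda>_. count_space UNIV)"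

definition weight_diverges :: "'s wdtmc \<Rightarrow> (nat \<Rightarrow> 's) \<Rightarrow> bool" where
  "weight_diverges M \<sigma> \<longleftrightarrow> (\<lambda>n. \<Sum>i<n. weight M (\<sigma> i) (\<sigma> (Suc i))) \<longlonglongrightarrow> -\<infinity>"

definition absolutely_convergent :: "'s wdtmc \<Rightarrow> 's \<Rightarrow> bool" where
  "absolutely_convergent M s0 \<longleftrightarrow> (\<forall>\<sigma>\<in>inf_paths M s0. weight_diverges M \<sigma>)"

definition almost_surely_convergent :: "'s wdtmc \<Rightarrow> 's \<Rightarrow> bool" where
  "almost_surely_convergent M s0 \<longleftrightarrow>
    measure (path_measure M s0) {\<sigma> \<in> inf_paths M s0. weight_diverges M \<sigma>} = 1"


section \<open>Probabilistic piecewise constant derivative systems\<close>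

text \<open>
  The facets of \<open>A\<close> are the inclusion-maximal nonempty polyhedral subsets of the topological boundary.
  This differs from \<open>facet_of\<close> for polyhedra with empty interior, which are their own boundary.
\<close>

definition facets :: "(real^'n) set \<Rightarrow> (real^'n) set set" where
  "facets A = {f. polyhedron f \<and> f \<noteq> {} \<and> f \<subseteq> frontier A \<and>
     (\<forall>g. polyhedron g \<and> g \<subseteq> frontier A \<and> f \<subseteq> g \<longrightarrow> g = f)}"

definition pos_scaling_invariant :: "(real^'n) set \<Rightarrow> bool" where
  "pos_scaling_invariant A \<longleftrightarrow> (\<forall>x\<in>A. \<forall>\<alpha>>0. \<alpha> *\<^sub>R x \<in> A)"

record ('q, 'n) ppcd =
  Inv :: "'q \<Rightarrow> (real^'n) set"
  Flow :: "'q \<Rightarrow> real^'n"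
  Edges :: "('q \<times> (real^'n) set \<times> 'q pmf) set"

definition ppcd :: "('q::finite, 'n::finite) ppcd \<Rightarrow> bool" where
  "ppcd H \<longleftrightarrow>
    (\<forall>q. polyhedron (Inv H q) \<and> pos_scaling_invariant (Inv H q)) \<and>
    (\<forall>q f \<rho>. (q, f, \<rho>) \<in> Edges H \<longrightarrow> f \<in> facets (Inv H q)) \<and>
    (\<forall>q f \<rho> \<rho>'. (q, f, \<rho>) \<in> Edges H \<longrightarrow> (q, f, \<rho>') \<in> Edges H \<longrightarrow> \<rho> = \<rho>')"

definition all_facets :: "('q, 'n) ppcd \<Rightarrow> (real^'n) set set" where
  "all_facets H = (\<Union>q. facets (Inv H q))"

definition is_ray :: "(real^'n) set \<Rightarrow> bool" where
  "is_ray f \<longleftrightarrow> (\<exists>d. d \<noteq> 0 \<and> f = {t *\<^sub>R d | t. 0 \<le> t})"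

text \<open>
  That facets are rays excludes invariants such as half-planes, whose only facet is a line, and
  \<open>{0}\<close>.
\<close>

definition planar_ppcd :: "('q::finite, 2) ppcd \<Rightarrow> bool" where
  "planar_ppcd H \<longleftrightarrow> ppcd H \<and> (\<forall>f\<in>all_facets H. is_ray f)"

definition cont_transition :: "('q, 'n::finite) ppcd \<Rightarrow> 'q \<Rightarrow> real^'n \<Rightarrow> real^'n \<Rightarrow> bool" where
  "cont_transition H q x1 x2 \<longleftrightarrow> x1 \<in> Inv H q \<and> x2 \<in> Inv H q \<and>
    (\<exists>T>0. x2 = x1 + T *\<^sub>R Flow H q \<and> x2 \<in> frontier (Inv H q) \<and>
       (\<forall>t. 0 < t \<and> t < T \<longrightarrow> x1 + t *\<^sub>R Flow H q \<notin> frontier (Inv H q)))"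

definition infinite_edge :: "('q, 'n::finite) ppcd \<Rightarrow> 'q \<Rightarrow> real^'n \<Rightarrow> bool" where
  "infinite_edge H q x \<longleftrightarrow> (\<forall>t\<ge>0. x + t *\<^sub>R Flow H q \<in> Inv H q)"

definition disc_transition ::
  "('q, 'n::finite) ppcd \<Rightarrow> 'q \<Rightarrow> 'q \<Rightarrow> real \<Rightarrow> 'q pmf \<Rightarrow> (real^'n) set \<Rightarrow> bool" where
  "disc_transition H q1 q2 p \<rho> f \<longleftrightarrow>
    f \<in> facets (Inv H q1) \<and> f \<subseteq> Inv H q2 \<and> (q1, f, \<rho>) \<in> Edges H \<and> p = pmf \<rho> q2"

definition jump :: "('q, 'n::finite) ppcd \<Rightarrow> 'q \<times> (real^'n) \<Rightarrow> 'q \<times> (real^'n) \<Rightarrow> real \<Rightarrow> bool" where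
  "jump H s1 s2 p \<longleftrightarrow> cont_transition H (fst s1) (snd s1) (snd s2) \<and>
    (\<exists>\<rho> f. disc_transition H (fst s1) (fst s2) p \<rho> f \<and> snd s2 \<in> f)"

text \<open>
  The value \<open>p\<close> of a jump can only be ambiguous if the target point lies in several facets; for
  reachable sources, \<open>semantics_well_defined\<close> below rules this out.
\<close>

definition semantics :: "('q, 'n::finite) ppcd \<Rightarrow> ('q \<times> (real^'n)) wdtmc" where
  "semantics H = \<lparr>
     states = UNIV,
     tprob = (\<lambda>s1 s2.
       if infinite_edge H (fst s1) (snd s1) then (if s2 = s1 then 1 else 0)
       else if \<exists>p. jump H s1 s2 p then (THE p. jump H s1 s2 p)
       else 0),
     weight = (\<lambda>s1 s2.
       if infinite_edge H (fst s1) (snd s1) then (if s2 = s1 then \<infinity> else 0)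
       else if \<exists>p. jump H s1 s2 p then ereal (ln (infnorm (snd s2) / infnorm (snd s1)))
       else 0) \<rparr>"

definition semantics_well_defined :: "('q, 'n::finite) ppcd \<Rightarrow> 'q \<times> (real^'n) \<Rightarrow> bool" where
  "semantics_well_defined H s0 \<longleftrightarrow>
    wdtmc_from (semantics H) s0 \<and>
    (\<forall>s\<in>reachable (semantics H) s0.
       snd s \<noteq> 0 \<and> (\<forall>s'. \<exists>\<^sub>\<le>\<^sub>1 p. jump H s s' p))"

definition converges_to_0 :: "(nat \<Rightarrow> 'q \<times> (real^'n)) \<Rightarrow> bool" where
  "converges_to_0 \<sigma> \<longleftrightarrow> (\<lambda>i. infnorm (snd (\<sigma> i))) \<longlonglongrightarrow> 0"

definition absolutely_stable :: "('q, 'n::finite) ppcd \<Rightarrow> 'q \<times> (real^'n) \<Rightarrow> bool" where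
  "absolutely_stable H s0 \<longleftrightarrow> (\<forall>\<sigma>\<in>inf_paths (semantics H) s0. converges_to_0 \<sigma>)"

definition almost_surely_stable :: "('q, 'n::finite) ppcd \<Rightarrow> 'q \<times> (real^'n) \<Rightarrow> bool" where
  "almost_surely_stable H s0 \<longleftrightarrow>
    measure (path_measure (semantics H) s0)
      {\<sigma> \<in> inf_paths (semantics H) s0. converges_to_0 \<sigma>} = 1"


section \<open>The quotient of a planar system\<close>

definition represents ::
  "('q, 2) ppcd \<Rightarrow> 'q \<times> (real^2) set \<Rightarrow> 'q \<times> (real^2) set \<Rightarrow> real^2 \<Rightarrow> real^2 \<Rightarrow> bool" where
  "represents H u1 u2 x1 x2 \<longleftrightarrow>
    snd u1 \<in> all_facets H \<and> snd u2 \<in> all_facets H \<and>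
    x1 \<in> snd u1 \<and> x2 \<in> snd u2 \<and> x1 \<noteq> 0 \<and> x2 \<noteq> 0 \<and>
    0 < tprob (semantics H) (fst u1, x1) (fst u2, x2)"

text \<open>
  For a planar system the definite descriptions are proper: scaling a representing pair of points
  changes neither probability nor weight.
\<close>

definition ppcd_quotient :: "('q, 2) ppcd \<Rightarrow> ('q \<times> (real^2) set) wdtmc" where
  "ppcd_quotient H = \<lparr>
     states = UNIV \<times> all_facets H,
     tprob = (\<lambda>u1 u2.
       if \<exists>x1 x2. represents H u1 u2 x1 x2
       then (THE p. \<exists>x1 x2. represents H u1 u2 x1 x2 \<and>
                      p = tprob (semantics H) (fst u1, x1) (fst u2, x2))
       else 0),
     weight = (\<lambda>u1 u2.
       if \<exists>x1 x2. represents H u1 u2 x1 x2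
       then (THE w. \<exists>x1 x2. represents H u1 u2 x1 x2 \<and>
                      w = weight (semantics H) (fst u1, x1) (fst u2, x2))
       else 0) \<rparr>"


section \<open>The path measure on cylinder sets\<close>

lemma Ionescu_Tulcea_path_kernel:
  "Ionescu_Tulcea (path_kernel M s0) (\<lambda>_. count_space UNIV)"
proof (rule Ionescu_Tulcea.intro)
  fix i :: nat
  show "path_kernel M s0 i \<in>
      measurable (Pi\<^sub>M {0..<i} (\<lambda>_. count_space UNIV)) (subprob_algebra (count_space UNIV))"
  proof (cases i)
    case 0
    then show ?thesis
      by (simp add: path_kernel_def[abs_def] space_subprob_algebra
            measure_pmf.subprob_space_axioms)
  next
    case (Suc k)
    have "(\<lambda>\<sigma>. \<sigma> k) \<in> measurable (Pi\<^sub>M {0..<i} (\<lambda>_. count_space UNIV)) (count_space UNIV)"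
      using Suc by (intro measurable_component_singleton) auto
    moreover have "(\<lambda>s. measure_pmf (next_pmf M s)) \<in>
        measurable (count_space UNIV) (subprob_algebra (count_space UNIV))"
      by (simp add: space_subprob_algebra measure_pmf.subprob_space_axioms)
    ultimately show ?thesis
      using Suc by (auto simp: path_kernel_def[abs_def] intro: measurable_compose)
  qed
next
  show "prob_space (path_kernel M s0 i x)" for i :: nat and x
    by (simp add: path_kernel_def measure_pmf.prob_space_axioms)
qed

lemma prob_space_path_measure: "prob_space (path_measure M s0)"
proof -
  interpret IT: Ionescu_Tulcea "path_kernel M s0" "\<lambda>_. count_space UNIV"
    by (rule Ionescu_Tulcea_path_kernel)
  let ?E = "space (Pi\<^sub>M {} (\<lambda>_. count_space UNIV)) :: (nat \<Rightarrow> 'a) set"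
  have "emeasure IT.PF.lim (IT.PF.emb UNIV {} ?E) = emeasure (IT.CI {}) ?E"
    by (rule IT.lim) auto
  also have "\<dots> = 1"
    using prob_space.emeasure_space_1[OF IT.PF.prob_space_P[of "{}"]]
    by (simp add: IT.CI_def)
  finally have "emeasure IT.PF.lim (space IT.PF.lim) = 1"
    by (simp add: prod_emb_def space_PiM restrict_def[abs_def])
  then show ?thesis
    unfolding path_measure_def by (rule prob_spaceI)
qed

lemma sets_path_measure:
  "sets (path_measure M s0) = sets (Pi\<^sub>M UNIV (\<lambda>_. count_space UNIV))"
proof -
  interpret IT: Ionescu_Tulcea "path_kernel M s0" "\<lambda>_. count_space UNIV"
    by (rule Ionescu_Tulcea_path_kernel)
  show ?thesis
    by (simp add: path_measure_def IT.PF.sets_lim)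
qed

lemma emeasure_path_measure_cylinder:
  "emeasure (path_measure M s0) {\<sigma>. \<forall>i\<le>n. \<sigma> i = s i} =
    ennreal ((if s 0 = s0 then 1 else 0) * (\<Prod>i<n. pmf (next_pmf M (s i)) (s (Suc i))))"
proof -
  interpret IT: Ionescu_Tulcea "path_kernel M s0" "\<lambda>_. count_space UNIV"
    by (rule Ionescu_Tulcea_path_kernel)
  let ?X = "\<lambda>m. Pi\<^sub>E {0..<m} (\<lambda>i. {s i})"
  let ?q = "\<lambda>m. case m of 0 \<Rightarrow> (if s 0 = s0 then 1 else 0) | Suc k \<Rightarrow> pmf (next_pmf M (s k)) (s m)"
  have X: "?X m \<in> sets (Pi\<^sub>M {0..<m} (\<lambda>_. count_space UNIV))" for m
    by (intro sets_PiM_I_finite) auto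
  have [simp]: "(\<lambda>x. undefined) \<in> space (Pi\<^sub>M {0..<0::nat} (\<lambda>_. count_space UNIV))"
    by (simp add: space_PiM)
  have C: "emeasure (IT.C 0 m (\<lambda>x. undefined)) (?X m) = ennreal (\<Prod>i<m. ?q i)" for m
  proof (induction m)
    case 0
    have "(\<lambda>x. undefined) \<in> (?X 0 :: (nat \<Rightarrow> _) set)"
      by simp
    with X[of 0] show ?case
      by (simp only: IT.C.simps emeasure_return) simp
  next
    case (Suc m)
    have eP: "emeasure (IT.eP m x) (?X (Suc m)) = ennreal (?q m) * indicator (?X m) x"
      if x: "x \<in> space (Pi\<^sub>M {0..<m} (\<lambda>_. count_space UNIV))" for x
    proof -
      have "(\<lambda>y. fun_upd x m y) -` ?X (Suc m) \<inter> space (count_space UNIV) =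
          (if x \<in> ?X m then {s m} else {})"
      proof -
        have xe: "x \<in> extensional {0..<m}"
          using x by (auto simp: space_PiM PiE_iff)
        have "x(m := y) \<in> ?X (Suc m) \<longleftrightarrow> x \<in> ?X m \<and> y = s m" for y
          using xe
          by (auto simp: PiE_iff extensional_def less_Suc_eq
                split: if_splits)
        then show ?thesis by auto
      qed
      moreover have "emeasure (path_kernel M s0 m x) {s m} = ennreal (?q m)" if "x \<in> ?X m"
        using that
        by (cases m) (auto simp: path_kernel_def emeasure_pmf_single PiE_iff)
      ultimately show ?thesis
        using IT.emeasure_eP[OF x X[of "Suc m"]] by (auto simp: indicator_def)
    qed
    have "emeasure (IT.C 0 (Suc m) (\<lambda>x. undefined)) (?X (Suc m)) =
        (\<integral>\<^sup>+x. emeasure (IT.eP m x) (?X (Suc m)) \<partial>IT.C 0 m (\<lambda>x. undefined))"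
      unfolding IT.C.simps(2) add_0
    proof (rule emeasure_bind)
      show "space (IT.C 0 m (\<lambda>x. undefined)) \<noteq> {}"
        by (rule prob_space.not_empty[OF IT.prob_space_C]) simp
      show "IT.eP m \<in> measurable (IT.C 0 m (\<lambda>x. undefined))
          (subprob_algebra (Pi\<^sub>M {0..<Suc m} (\<lambda>_. count_space UNIV)))"
        using IT.measurable_eP[of m] IT.sets_C[of "\<lambda>x. undefined" 0 m]
        by (simp cong: measurable_cong_sets)
    qed (rule X)
    also have "\<dots> = (\<integral>\<^sup>+x. ennreal (?q m) * indicator (?X m) x \<partial>IT.C 0 m (\<lambda>x. undefined))"
      by (intro nn_integral_cong eP) (simp add: IT.space_C)
    also have "\<dots> = ennreal (?q m) * emeasure (IT.C 0 m (\<lambda>x. undefined)) (?X m)"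
      by (rule nn_integral_cmult_indicator) (simp add: IT.sets_C X[simplified])
    also have "\<dots> = ennreal (\<Prod>i<Suc m. ?q i)"
      unfolding Suc.IH
      by (subst ennreal_mult[symmetric])
         (auto intro!: prod_nonneg simp: mult.commute split: nat.split)
    finally show ?case .
  qed
  have "{\<sigma>. \<forall>i\<le>n. \<sigma> i = s i} = IT.PF.emb UNIV {0..<Suc n} (?X (Suc n))"
    by (auto simp: prod_emb_def space_PiM PiE_iff less_Suc_eq_le)
  then have "emeasure (path_measure M s0) {\<sigma>. \<forall>i\<le>n. \<sigma> i = s i} =
      emeasure (IT.CI {0..<Suc n}) (?X (Suc n))"
    unfolding path_measure_def using IT.lim[OF _ X[of "Suc n"]] by simp
  also have "\<dots> = emeasure (IT.C 0 (Suc n) (\<lambda>x. undefined)) (?X (Suc n))"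
    using IT.emeasure_CI[OF order_refl X[of "Suc n"]] sets.sets_into_space[OF X[of "Suc n"]]
    by (simp add: prod_emb_id)
  also have "\<dots> = ennreal (\<Prod>i<Suc n. ?q i)"
    by (rule C)
  also have "(\<Prod>i<Suc n. ?q i) =
      (if s 0 = s0 then 1 else 0) * (\<Prod>i<n. pmf (next_pmf M (s i)) (s (Suc i)))"
    by (subst prod.lessThan_Suc_shift) simp
  finally show ?thesis .
qed

end

theory Submission
  imports Defs
begin

text \<open>
  Scaling the continuous state by a positive factor changes neither probabilities nor weights, and
  all facets of a planar system are rays. Hence sending a state to its location and the ray through
  its point is a covering of the quotient by the semantics: the edges out of a reachable state
  correspond bijectively, with equal probabilities and weights, to the edges out of its image. A
  covering lifts infinite paths uniquely, and it pushes the path measure forward to the path measure,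
  because path measures are determined by cylinder sets once they live on countably many states.
  Along a path of the semantics, the weights telescope to \<open>ln (\<parallel>x\<^sub>n\<parallel> / \<parallel>x\<^sub>0\<parallel>)\<close>, which tends to
  \<open>-\<infinity>\<close> iff the path converges to \<open>0\<close>.
\<close>

section \<open>Paths of weighted Markov chains\<close>

lemma reachable_refl: "s0 \<in> reachable M s0"
  by (simp add: reachable_def)

lemma reachable_step: "s \<in> reachable M s0 \<Longrightarrow> is_edge M s s' \<Longrightarrow> s' \<in> reachable M s0"
  by (simp add: reachable_def)

lemma inf_paths_reachable: "\<sigma> \<in> inf_paths M s0 \<Longrightarrow> \<sigma> i \<in> reachable M s0"
  by (induction i) (auto simp: inf_paths_def reachable_refl intro: reachable_step)

lemma wdtmc_from_is_dist:
  "wdtmc_from M s0 \<Longrightarrow> s \<in> reachable M s0 \<Longrightarrow> is_dist (states M) (tprob M s)"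
  by (simp add: wdtmc_from_def)

text \<open>\<open>embed_pmf\<close> inverts \<open>pmf\<close>, so on a row that is a distribution
  the absorbing default of \<open>next_pmf\<close> does not apply.\<close>

lemma pmf_next_pmf:
  assumes "is_dist (states M) (tprob M s)"
  shows "pmf (next_pmf M s) s' = tprob M s s'"
proof -
  obtain p where "pmf p = tprob M s"
    using assms by (auto simp: is_dist_def)
  moreover from this have "embed_pmf (tprob M s) = p"
    using type_definition.Rep_inverse[OF td_pmf_embed_pmf, of p] by simp
  ultimately show ?thesis
    using assms by (simp add: next_pmf_def)
qed

lemma set_next_pmf:
  assumes "is_dist (states M) (tprob M s)" and "s \<in> states M"
  shows "set_pmf (next_pmf M s) = {s'. is_edge M s s'}"
proof -
  obtain p where p: "set_pmf p \<subseteq> states M" "pmf p = tprob M s"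
    using assms by (auto simp: is_dist_def)
  have "s' \<in> set_pmf (next_pmf M s) \<longleftrightarrow> is_edge M s s'" for s'
    using p assms(2) pmf_next_pmf[OF assms(1), of s'] pmf_nonneg[of p s']
    by (fastforce simp: is_edge_def set_pmf_iff)
  then show ?thesis by blast
qed

lemma reachable_states:
  assumes "wdtmc_from M s0" "s \<in> reachable M s0"
  shows "s \<in> states M"
proof -
  have "(is_edge M)\<^sup>*\<^sup>* s0 s"
    using assms by (simp add: reachable_def)
  then show ?thesis
    using assms(1) by induction (auto simp: wdtmc_from_def is_edge_def)
qed

text \<open>A pmf has countable support, so countably many states are reached in each number of
  steps, even from a continuum of states. This countability carries all later measurability and
  almost-sure arguments.\<close>

lemma countable_reachable:
  assumes "wdtmc_from M s0"
  shows "countable (reachable M s0)"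
proof -
  have "countable {s. (is_edge M ^^ n) s0 s}" for n
  proof (induction n)
    case (Suc n)
    have "{s. (is_edge M ^^ Suc n) s0 s} =
        (\<Union>z\<in>{s. (is_edge M ^^ n) s0 s}. {s. is_edge M z s})"
      by auto
    moreover have "countable {s. is_edge M z s}" if "(is_edge M ^^ n) s0 z" for z
    proof -
      have "z \<in> reachable M s0"
        using that by (auto simp: reachable_def rtranclp_power)
      then show ?thesis
        using assms countable_set_pmf[of "next_pmf M z"]
        by (simp add: set_next_pmf wdtmc_from_is_dist reachable_states)
    qed
    ultimately show ?case
      using Suc by (metis (no_types, lifting) countable_UN mem_Collect_eq)
  qed simp
  moreover have "reachable M s0 = (\<Union>n. {s. (is_edge M ^^ n) s0 s})"
    by (auto simp: reachable_def rtranclp_power)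
  ultimately show ?thesis by simp
qed

section \<open>Almost sure properties of the path measure\<close>

lemma space_path_measure: "space (path_measure M s0) = UNIV"
  using sets_eq_imp_space_eq[OF sets_path_measure[of M s0]] by (simp add: space_PiM)

lemma measurable_path_component:
  "sets P = sets (Pi\<^sub>M UNIV (\<lambda>_. count_space UNIV)) \<Longrightarrow>
    (\<lambda>\<sigma>. \<sigma> i) \<in> measurable P (count_space UNIV)"
  by (subst measurable_cong_sets[OF _ refl, of P "Pi\<^sub>M UNIV (\<lambda>_. count_space UNIV)"])
     (auto intro!: measurable_component_singleton)

lemma pred_path_component:
  "sets P = sets (Pi\<^sub>M UNIV (\<lambda>_. count_space UNIV)) \<Longrightarrow> Measurable.pred P (\<lambda>\<sigma>. \<sigma> i \<in> A)"
  by (rule measurable_compose[OF measurable_path_component]) auto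

lemma sets_cylinder:
  assumes "sets P = sets (Pi\<^sub>M UNIV (\<lambda>_. count_space UNIV))"
  shows "{\<sigma> :: nat \<Rightarrow> 'a. \<forall>i\<le>n. \<sigma> i = s i} \<in> sets P"
proof -
  note [measurable] = measurable_path_component[OF assms]
  have "space P = UNIV"
    using sets_eq_imp_space_eq[OF assms] by (simp add: space_PiM)
  moreover have "{\<sigma>\<in>space P. \<forall>i\<le>n. \<sigma> i = s i} \<in> sets P"
    by measurable
  ultimately show ?thesis by simp
qed

lemma AE_path_measure_start: "AE \<sigma> in path_measure M s0. \<sigma> 0 = s0"
proof -
  interpret prob_space "path_measure M s0"
    by (rule prob_space_path_measure)
  have "emeasure (path_measure M s0) {\<sigma>. \<sigma> 0 = s0} = 1"
    using emeasure_path_measure_cylinder[of M s0 0 "\<lambda>_. s0"] by simp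
  then have "prob {\<sigma>. \<sigma> 0 = s0} = 1"
    by (simp add: measure_def)
  from AE_prob_1[OF this] show ?thesis by simp
qed

text \<open>The one-step extensions of a cylinder along the support of \<open>next_pmf\<close> are
  disjoint and their masses add up to the mass of the cylinder, so what remains of the cylinder is
  null. Fixing the whole prefix \<open>s\<close> keeps every event a countable union of cylinders,
  whose measures are known.\<close>

lemma AE_path_measure_step:
  fixes M :: "'a wdtmc"
  shows "AE \<sigma> in path_measure M s0.
    (\<forall>i\<le>n. \<sigma> i = s i) \<longrightarrow> \<sigma> (Suc n) \<in> set_pmf (next_pmf M (s n))"
proof -
  let ?P = "path_measure M s0" and ?p = "next_pmf M (s n)"
  let ?C = "{\<sigma>. \<forall>i\<le>n. \<sigma> i = s i}"
  let ?D = "\<lambda>s'. {\<sigma>. \<forall>i\<le>Suc n. \<sigma> i = (s(Suc n := s')) i}"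
  interpret prob_space ?P
    by (rule prob_space_path_measure)
  \<comment> \<open>\<open>c\<close> is the measure of the cylinder \<open>?C\<close>; extending the
    prefix by \<open>s'\<close> multiplies it by \<open>pmf ?p s'\<close>.\<close>
  define c where "c = (if s 0 = s0 then 1 else 0) * (\<Prod>i<n. pmf (next_pmf M (s i)) (s (Suc i)))"
  have c: "0 \<le> c"
    by (auto simp: c_def intro!: prod_nonneg)
  have C: "?C \<in> sets ?P" and D: "?D s' \<in> sets ?P" for s'
    by (intro sets_cylinder sets_path_measure)+
  have UD: "(\<Union>s'\<in>set_pmf ?p. ?D s') \<in> sets ?P"
    using D by (intro sets.countable_UN' countable_set_pmf) blast
  have disj: "disjoint_family_on ?D (set_pmf ?p)"
    unfolding disjoint_family_on_def
  proof (intro ballI impI)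
    fix a b :: 'a assume "a \<noteq> b"
    moreover have "\<sigma> (Suc n) = s'" if "\<sigma> \<in> ?D s'" for \<sigma> s'
      using that by simp
    ultimately show "?D a \<inter> ?D b = {}" by blast
  qed
  have "emeasure ?P (?D s') = ennreal c * ennreal (pmf ?p s')" for s'
  proof -
    have "(\<Prod>i<Suc n. pmf (next_pmf M ((s(Suc n := s')) i)) ((s(Suc n := s')) (Suc i))) =
        (\<Prod>i<n. pmf (next_pmf M (s i)) (s (Suc i))) * pmf ?p s'"
      by simp
    then show ?thesis
      unfolding emeasure_path_measure_cylinder
      using c by (simp add: c_def flip: ennreal_mult)
  qed
  moreover have "emeasure ?P (\<Union>s'\<in>set_pmf ?p. ?D s') =
      (\<integral>\<^sup>+s'. emeasure ?P (?D s') \<partial>count_space (set_pmf ?p))"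
    using disj by (intro emeasure_UN_countable D countable_set_pmf)
  ultimately have "emeasure ?P (\<Union>s'\<in>set_pmf ?p. ?D s') =
      (\<integral>\<^sup>+s'. ennreal c * ennreal (pmf ?p s') \<partial>count_space (set_pmf ?p))"
    by simp
  also have "\<dots> = ennreal c"
    by (simp add: nn_integral_cmult nn_integral_pmf emeasure_pmf)
  also have "\<dots> = emeasure ?P ?C"
    by (simp add: emeasure_path_measure_cylinder c_def)
  finally have eq: "emeasure ?P (\<Union>s'\<in>set_pmf ?p. ?D s') = emeasure ?P ?C" .
  have sub: "(\<Union>s'\<in>set_pmf ?p. ?D s') \<subseteq> ?C"
  proof (intro UN_least subsetI)
    fix \<sigma> s' assume "\<sigma> \<in> ?D s'"
    then have "\<sigma> i = (s(Suc n := s')) i" if "i \<le> n" for i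
      using that by (simp only: mem_Collect_eq)
    then show "\<sigma> \<in> ?C" by simp
  qed
  have "emeasure ?P (?C - (\<Union>s'\<in>set_pmf ?p. ?D s')) = 0"
    using emeasure_Diff[OF _ C UD sub] unfolding eq
    by (simp only: ennreal_diff_self emeasure_finite infinity_ennreal_def not_False_eq_True)
  then have "?C - (\<Union>s'\<in>set_pmf ?p. ?D s') \<in> null_sets ?P"
    using C UD by (simp only: null_sets_def mem_Collect_eq sets.Diff)
  from AE_not_in[OF this] show ?thesis
    by eventually_elim (auto simp: le_Suc_eq)
qed

lemma AE_inf_paths:
  assumes "wdtmc_from M s0"
  shows "AE \<sigma> in path_measure M s0. \<sigma> \<in> inf_paths M s0"
proof -
  let ?R = "reachable M s0"
  have R: "countable ?R"
    using assms by (rule countable_reachable)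
  \<comment> \<open>Extensional prefixes with values in \<open>?R\<close> are countable in number,
    so the null sets of all of them can be discarded together.\<close>
  have "countable (Pi\<^sub>E {..n} (\<lambda>_. ?R))" for n :: nat
    by (rule countable_PiE) (use R in auto)
  then have "AE \<sigma> in path_measure M s0. \<forall>n. \<forall>w\<in>Pi\<^sub>E {..n} (\<lambda>_. ?R).
      (\<forall>i\<le>n. \<sigma> i = w i) \<longrightarrow> \<sigma> (Suc n) \<in> set_pmf (next_pmf M (w n))"
    by (simp only: AE_all_countable AE_ball_countable AE_path_measure_step simp_thms ball_triv)
  with AE_path_measure_start show ?thesis
  proof eventually_elim
    case (elim \<sigma>)
    \<comment> \<open>A reachable initial segment of \<sigma>, restricted to \<open>{..n}\<close>,
      is itself one of these prefixes.\<close>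
    have step: "is_edge M (\<sigma> n) (\<sigma> (Suc n))" if "\<forall>i\<le>n. \<sigma> i \<in> ?R" for n
    proof -
      have "restrict \<sigma> {..n} \<in> Pi\<^sub>E {..n} (\<lambda>_. ?R)"
        using that by auto
      from bspec[OF spec[OF elim(2)] this] have "\<sigma> (Suc n) \<in> set_pmf (next_pmf M (\<sigma> n))"
        by simp
      then show ?thesis
        using that assms by (simp add: set_next_pmf wdtmc_from_is_dist reachable_states)
    qed
    have "\<forall>i\<le>n. \<sigma> i \<in> ?R" for n
    proof (induction n)
      case 0
      then show ?case using elim(1) by (simp add: reachable_refl)
    next
      case (Suc n)
      from reachable_step[OF _ step[OF Suc]] Suc have "\<sigma> (Suc n) \<in> ?R"
        by blast
      with Suc show ?case
        by (metis le_SucE)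
    qed
    with step elim(1) show ?case
      by (auto simp: inf_paths_def)
  qed
qed

text \<open>On an uncountable state space, cylinders around single prefixes do not generate the
  product \<sigma>-algebra. If both measures live on paths in a countable \<open>R\<close>, each
  finite-dimensional event is, up to a null set, a countable disjoint union of such
  cylinders.\<close>

lemma measure_eqI_cylinder:
  fixes P Q :: "(nat \<Rightarrow> 'a) measure"
  assumes P: "sets P = sets (Pi\<^sub>M UNIV (\<lambda>_. count_space UNIV))"
    and Q: "sets Q = sets (Pi\<^sub>M UNIV (\<lambda>_. count_space UNIV))"
    and "finite_measure P"
    and R: "countable R" "AE \<sigma> in P. \<forall>i. \<sigma> i \<in> R" "AE \<sigma> in Q. \<forall>i. \<sigma> i \<in> R"
    and eq: "\<And>n s. emeasure P {\<sigma>. \<forall>i\<le>n. \<sigma> i = s i} = emeasure Q {\<sigma>. \<forall>i\<le>n. \<sigma> i = s i}"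
  shows "P = Q"
proof (rule measure_eqI_PiM_infinite[where I = UNIV and M = "\<lambda>_. count_space UNIV", OF P Q _ \<open>finite_measure P\<close>])
  fix A :: "nat \<Rightarrow> 'a set" and J :: "nat set"
  assume J: "finite J"
  let ?X = "{\<sigma>. \<forall>j\<in>J. \<sigma> j \<in> A j}"
  obtain n where n: "J \<subseteq> {..n}"
    using J finite_nat_iff_bounded_le by blast
  \<comment> \<open>All prefixes in \<open>R\<close> up to time \<open>n\<close> that satisfy the
    constraints; since \<open>n\<close> bounds \<open>J\<close>, a prefix decides all of
    them.\<close>
  let ?W = "{w \<in> Pi\<^sub>E {..n} (\<lambda>_. R). \<forall>j\<in>J. w j \<in> A j}"
  let ?C = "\<lambda>w. {\<sigma>. \<forall>i\<le>n. \<sigma> i = w i}"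
  have W: "countable ?W"
    using R(1) by (auto intro!: countable_subset[OF _ countable_PiE[of "{..n}" "\<lambda>_. R"]])
  have disj: "disjoint_family_on ?C ?W"
    unfolding disjoint_family_on_def
  proof (intro ballI impI)
    fix v w assume "v \<in> ?W" "w \<in> ?W" "v \<noteq> w"
    then obtain i where "i \<le> n" "v i \<noteq> w i"
      using extensionalityI[of v "{..n}" w] by (auto simp: PiE_iff)
    then show "?C v \<inter> ?C w = {}" by auto
  qed
  have X: "{\<sigma>\<in>?X. \<forall>i\<le>n. \<sigma> i \<in> R} = (\<Union>w\<in>?W. ?C w)"
  proof (intro equalityI subsetI)
    fix \<sigma> assume "\<sigma> \<in> {\<sigma>\<in>?X. \<forall>i\<le>n. \<sigma> i \<in> R}"
    then have "restrict \<sigma> {..n} \<in> ?W" "\<sigma> \<in> ?C (restrict \<sigma> {..n})"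
      using n by auto
    then show "\<sigma> \<in> (\<Union>w\<in>?W. ?C w)" by blast
  next
    fix \<sigma> assume "\<sigma> \<in> (\<Union>w\<in>?W. ?C w)"
    then show "\<sigma> \<in> {\<sigma>\<in>?X. \<forall>i\<le>n. \<sigma> i \<in> R}"
      using n by (fastforce simp: PiE_iff)
  qed
  have *: "emeasure N ?X = (\<integral>\<^sup>+w. emeasure N (?C w) \<partial>count_space ?W)"
    if N: "sets N = sets (Pi\<^sub>M UNIV (\<lambda>_. count_space UNIV))" and ae: "AE \<sigma> in N. \<forall>i. \<sigma> i \<in> R"
    for N :: "(nat \<Rightarrow> 'a) measure"
  proof -
    note [measurable] = pred_path_component[OF N]
    have sp: "space N = UNIV"
      using sets_eq_imp_space_eq[OF N] by (simp add: space_PiM)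
    have X_sets: "{\<sigma>\<in>space N. \<forall>j\<in>J. \<sigma> j \<in> A j} \<in> sets N"
      using J by measurable
    have "emeasure N ?X = emeasure N {\<sigma>\<in>?X. \<forall>i\<le>n. \<sigma> i \<in> R}"
    proof (rule emeasure_eq_AE[rotated])
      show "?X \<in> sets N"
        using X_sets by (simp add: sp)
      show "{\<sigma>\<in>?X. \<forall>i\<le>n. \<sigma> i \<in> R} \<in> sets N"
        unfolding X using W by (intro sets.countable_UN') (auto intro: sets_cylinder[OF N])
      show "AE \<sigma> in N. \<sigma> \<in> ?X \<longleftrightarrow> \<sigma> \<in> {\<sigma>\<in>?X. \<forall>i\<le>n. \<sigma> i \<in> R}"
        using ae by eventually_elim simp
    qed
    also have "\<dots> = (\<integral>\<^sup>+w. emeasure N (?C w) \<partial>count_space ?W)"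
      unfolding X using W disj by (intro emeasure_UN_countable sets_cylinder N)
    finally show ?thesis .
  qed
  have "prod_emb UNIV (\<lambda>_. count_space UNIV) J (Pi\<^sub>E J A) = ?X"
    by (auto simp: prod_emb_def space_PiM PiE_iff)
  then show "emeasure P (prod_emb UNIV (\<lambda>_. count_space UNIV) J (Pi\<^sub>E J A)) =
      emeasure Q (prod_emb UNIV (\<lambda>_. count_space UNIV) J (Pi\<^sub>E J A))"
    using *[OF P R(2)] *[OF Q R(3)] by (simp add: eq)
qed

text \<open>
  The product of two discrete \<open>\<sigma>\<close>-algebras need not be discrete, so the state space is retracted onto
  a countable set \<open>R\<close>; otherwise not every function of two consecutive states would be measurable.
\<close>

lemma borel_measurable_path_pair:
  fixes h :: "'s \<Rightarrow> 's \<Rightarrow> 'b :: topological_space"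
  assumes "countable R" "s0 \<in> R" "sets P = sets (Pi\<^sub>M UNIV (\<lambda>_. count_space UNIV))"
  defines "r \<equiv> \<lambda>s. if s \<in> R then s else s0"
  shows "(\<lambda>\<sigma>. h (r (\<sigma> i)) (r (\<sigma> (Suc i)))) \<in> borel_measurable P"
proof -
  have r: "(\<lambda>\<sigma>. r (\<sigma> j)) \<in> measurable P (count_space R)" for j
    using assms(2) by (intro measurable_compose[OF measurable_path_component[OF assms(3)]]) (auto simp: r_def)
  have "(\<lambda>\<sigma>. h s (r (\<sigma> (Suc i)))) \<in> borel_measurable P" for s
    by (rule measurable_compose[OF r]) simp
  from measurable_compose_countable'[OF this r \<open>countable R\<close>] show ?thesis .
qed

section \<open>Measurability of path events\<close>

lemma sets_inf_paths:
  assumes "wdtmc_from M s0"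
  shows "inf_paths M s0 \<in> sets (path_measure M s0)"
proof -
  let ?P = "path_measure M s0" and ?R = "reachable M s0"
  let ?r = "\<lambda>s. if s \<in> ?R then s else s0"
  \<comment> \<open>The edge relation becomes a real-valued function of two retracted states. The
    retraction \<open>?r\<close> is the identity on reachable states, so requiring all states to lie
    in \<open>?R\<close> recovers the true edge relation.\<close>
  let ?e = "\<lambda>\<sigma> i. if is_edge M (?r (\<sigma> i)) (?r (\<sigma> (Suc i))) then 1 else 0 :: real"
  note [measurable] = measurable_path_component[OF sets_path_measure[of M s0]]
    pred_path_component[OF sets_path_measure[of M s0]]
  have [measurable]: "(\<lambda>\<sigma>. ?e \<sigma> i) \<in> borel_measurable ?P" for i
    by (rule borel_measurable_path_pair[OF countable_reachable[OF assms] reachable_refl sets_path_measure])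
  have "{\<sigma>\<in>space ?P. (\<forall>i. \<sigma> i \<in> ?R \<and> ?e \<sigma> i = 1) \<and> \<sigma> 0 = s0} \<in> sets ?P"
    by measurable
  also have "{\<sigma>\<in>space ?P. (\<forall>i. \<sigma> i \<in> ?R \<and> ?e \<sigma> i = 1) \<and> \<sigma> 0 = s0} = inf_paths M s0"
  proof (intro equalityI subsetI)
    fix \<sigma> assume "\<sigma> \<in> inf_paths M s0"
    then show "\<sigma> \<in> {\<sigma>\<in>space ?P. (\<forall>i. \<sigma> i \<in> ?R \<and> ?e \<sigma> i = 1) \<and> \<sigma> 0 = s0}"
      using inf_paths_reachable[of \<sigma> M s0] by (simp add: inf_paths_def space_path_measure)
  qed (auto simp: inf_paths_def split: if_splits)
  finally show ?thesis .
qed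

lemma sets_weight_diverges:
  assumes "wdtmc_from M s0"
  shows "{\<sigma> \<in> inf_paths M s0. weight_diverges M \<sigma>} \<in> sets (path_measure M s0)"
proof -
  let ?P = "path_measure M s0" and ?R = "reachable M s0"
  let ?r = "\<lambda>s. if s \<in> ?R then s else s0"
  let ?w = "\<lambda>\<sigma> i. weight M (?r (\<sigma> i)) (?r (\<sigma> (Suc i)))"
  have [measurable]: "(\<lambda>\<sigma>. ?w \<sigma> i) \<in> borel_measurable ?P" for i
    by (rule borel_measurable_path_pair[OF countable_reachable[OF assms] reachable_refl sets_path_measure])
  \<comment> \<open>Tending to \<open>-\<infinity>\<close> is the same as having limsup
    \<open>-\<infinity>\<close>, which is a measurable condition on countably many partial
    sums.\<close>
  have "{\<sigma>\<in>space ?P. limsup (\<lambda>n. \<Sum>i<n. ?w \<sigma> i) = -\<infinity>} \<in> sets ?P"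
    by measurable
  with sets_inf_paths[OF assms]
  have "inf_paths M s0 \<inter> {\<sigma>\<in>space ?P. limsup (\<lambda>n. \<Sum>i<n. ?w \<sigma> i) = -\<infinity>} \<in> sets ?P"
    by blast
  also have "inf_paths M s0 \<inter> {\<sigma>\<in>space ?P. limsup (\<lambda>n. \<Sum>i<n. ?w \<sigma> i) = -\<infinity>} =
      {\<sigma> \<in> inf_paths M s0. weight_diverges M \<sigma>}"
  proof -
    have "limsup (\<lambda>n. \<Sum>i<n. ?w \<sigma> i) = -\<infinity> \<longleftrightarrow> weight_diverges M \<sigma>"
      if "\<sigma> \<in> inf_paths M s0" for \<sigma>
      using inf_paths_reachable[OF that]
      by (simp add: weight_diverges_def Limsup_MInfty)
    then show ?thesis
      unfolding space_path_measure by blast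
  qed
  finally show ?thesis .
qed

lemma almost_surely_convergent_iff_AE:
  assumes "wdtmc_from M s0"
  shows "almost_surely_convergent M s0 \<longleftrightarrow> (AE \<sigma> in path_measure M s0. weight_diverges M \<sigma>)"
proof -
  interpret prob_space "path_measure M s0"
    by (rule prob_space_path_measure)
  show ?thesis
    unfolding almost_surely_convergent_def prob_eq_1[OF sets_weight_diverges[OF assms]]
    using AE_inf_paths[OF assms] by auto
qed

section \<open>Coverings of weighted Markov chains\<close>

text \<open>The conditions are local: \<phi> is a bijection on the edges out of each reachable
  state, while distant states may share an image. \<open>edge_lift\<close> starts from a nonzero
  value rather than from an edge, so that it also rules out negative values and targets outside
  \<open>states N\<close>; that \<open>N\<close> is a WDTMC then follows.\<close>

locale wdtmc_covering =
  fixes M :: "'a wdtmc" and N :: "'b wdtmc" and s0 :: 'a and \<phi> :: "'a \<Rightarrow> 'b"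
  assumes wdtmc: "wdtmc_from M s0"
    and start: "\<phi> s0 \<in> states N"
    and edge: "\<And>s s'. s \<in> reachable M s0 \<Longrightarrow> is_edge M s s' \<Longrightarrow>
      is_edge N (\<phi> s) (\<phi> s') \<and> tprob N (\<phi> s) (\<phi> s') = tprob M s s' \<and>
      weight N (\<phi> s) (\<phi> s') = weight M s s'"
    and edge_lift: "\<And>s u. s \<in> reachable M s0 \<Longrightarrow> tprob N (\<phi> s) u \<noteq> 0 \<Longrightarrow>
      \<exists>s'. is_edge M s s' \<and> \<phi> s' = u"
    and edge_unique: "\<And>s s' s''. s \<in> reachable M s0 \<Longrightarrow> is_edge M s s' \<Longrightarrow> is_edge M s s'' \<Longrightarrow>
      \<phi> s' = \<phi> s'' \<Longrightarrow> s' = s''"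
begin

lemma edge_liftE:
  assumes "s \<in> reachable M s0" "is_edge N (\<phi> s) u"
  obtains s' where "is_edge M s s'" "\<phi> s' = u"
  using edge_lift[OF assms(1), of u] assms(2) by (auto simp: is_edge_def)

lemma reachable_lift:
  assumes "u \<in> reachable N (\<phi> s0)"
  obtains s where "s \<in> reachable M s0" "\<phi> s = u"
proof -
  have "(is_edge N)\<^sup>*\<^sup>* (\<phi> s0) u"
    using assms by (simp add: reachable_def)
  then have "\<exists>s\<in>reachable M s0. \<phi> s = u"
  proof induction
    case base
    show ?case by (intro bexI[of _ s0] refl reachable_refl)
  next
    case (step u v)
    then obtain s where s: "s \<in> reachable M s0" "\<phi> s = u" by blast
    with step obtain s' where "is_edge M s s'" "\<phi> s' = v" by (auto elim: edge_liftE)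
    with s show ?case by (auto intro: reachable_step)
  qed
  with that show ?thesis by blast
qed

text \<open>\<open>map_pmf\<close> adds up the mass of each fibre, but \<phi> is injective on the
  successors of \<open>s\<close>, so each image carries the probability of exactly one edge.\<close>

lemma tprob_covering:
  assumes s: "s \<in> reachable M s0"
  shows "tprob N (\<phi> s) = pmf (map_pmf \<phi> (next_pmf M s))"
proof
  fix u
  have set: "set_pmf (next_pmf M s) = {s'. is_edge M s s'}"
    using s wdtmc by (intro set_next_pmf wdtmc_from_is_dist reachable_states)
  show "tprob N (\<phi> s) u = pmf (map_pmf \<phi> (next_pmf M s)) u"
  proof (cases "\<exists>s'. is_edge M s s' \<and> \<phi> s' = u")
    case True
    then obtain s' where s': "is_edge M s s'" "\<phi> s' = u" by blast
    have "inj_on \<phi> (set_pmf (next_pmf M s))"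
      using edge_unique[OF s] by (auto simp: set inj_on_def)
    from pmf_map_inj[OF this, of s'] have "pmf (map_pmf \<phi> (next_pmf M s)) u = pmf (next_pmf M s) s'"
      using s' set by simp
    also have "\<dots> = tprob M s s'"
      by (rule pmf_next_pmf[OF wdtmc_from_is_dist[OF wdtmc s]])
    also have "\<dots> = tprob N (\<phi> s) u"
      using edge[OF s s'(1)] s'(2) by simp
    finally show ?thesis ..
  next
    case False
    then have "u \<notin> \<phi> ` set_pmf (next_pmf M s)"
      by (auto simp: set)
    moreover have "tprob N (\<phi> s) u = 0"
      using False edge_lift[OF s] by blast
    ultimately show ?thesis
      by (simp add: pmf_map_outside)
  qed
qed

lemma wdtmc_from_covering: "wdtmc_from N (\<phi> s0)"
  unfolding wdtmc_from_def
proof (intro conjI ballI allI impI start)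
  fix u assume "u \<in> reachable N (\<phi> s0)"
  then obtain s where s: "s \<in> reachable M s0" "u = \<phi> s"
    by (auto elim: reachable_lift)
  have "set_pmf (next_pmf M s) = {s'. is_edge M s s'}"
    using s wdtmc by (intro set_next_pmf wdtmc_from_is_dist reachable_states)
  then have "set_pmf (map_pmf \<phi> (next_pmf M s)) \<subseteq> states N"
    using edge[OF s(1)] by (auto simp: is_edge_def)
  then show "is_dist (states N) (tprob N u)"
    unfolding is_dist_def s(2) tprob_covering[OF s(1)] by blast
  fix v assume "is_edge N u v"
  with s obtain s' where s': "is_edge M s s'" "\<phi> s' = v"
    by (auto elim: edge_liftE)
  with s wdtmc have "weight M s s' \<noteq> -\<infinity>"
    by (simp add: wdtmc_from_def)
  with edge[OF s(1) s'(1)] s s' show "weight N u v \<noteq> -\<infinity>"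
    by simp
qed

section \<open>Images and unique lifts of infinite paths\<close>

lemma inf_paths_image: "\<sigma> \<in> inf_paths M s0 \<Longrightarrow> \<phi> \<circ> \<sigma> \<in> inf_paths N (\<phi> s0)"
  using edge[OF inf_paths_reachable] by (simp add: inf_paths_def)

lemma inf_paths_lift:
  assumes "u \<in> inf_paths N (\<phi> s0)"
  obtains \<sigma> where "\<sigma> \<in> inf_paths M s0" "\<phi> \<circ> \<sigma> = u"
proof -
  \<comment> \<open>Reachability belongs to the invariant because edges lift only from reachable
    states. The clause for \<open>n = 0\<close> fixes the starting point, as the fibre over
    \<open>u 0\<close> may contain other states.\<close>
  have "\<exists>\<sigma>. \<forall>n. (\<sigma> n \<in> reachable M s0 \<and> \<phi> (\<sigma> n) = u n \<and> (n = 0 \<longrightarrow> \<sigma> n = s0)) \<and>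
      is_edge M (\<sigma> n) (\<sigma> (Suc n))"
  proof (rule dependent_nat_choice)
    show "\<exists>s. s \<in> reachable M s0 \<and> \<phi> s = u 0 \<and> (0 = (0::nat) \<longrightarrow> s = s0)"
      using assms by (auto simp: inf_paths_def reachable_refl)
    fix s n assume s: "s \<in> reachable M s0 \<and> \<phi> s = u n \<and> (n = 0 \<longrightarrow> s = s0)"
    with assms have "is_edge N (\<phi> s) (u (Suc n))"
      by (simp add: inf_paths_def)
    with s obtain s' where s': "is_edge M s s'" "\<phi> s' = u (Suc n)"
      by (auto elim: edge_liftE)
    moreover from s s' have "s' \<in> reachable M s0"
      using reachable_step[of s M s0 s'] by blast
    ultimately show "\<exists>s'. (s' \<in> reachable M s0 \<and> \<phi> s' = u (Suc n) \<and> (Suc n = 0 \<longrightarrow> s' = s0)) \<and>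
        is_edge M s s'"
      by blast
  qed
  then obtain \<sigma> where "\<And>n. \<phi> (\<sigma> n) = u n" "\<sigma> 0 = s0" "\<And>n. is_edge M (\<sigma> n) (\<sigma> (Suc n))"
    by blast
  then show ?thesis
    by (intro that[of \<sigma>]) (auto simp: inf_paths_def)
qed

text \<open>Both paths start at \<open>s0\<close>, and \<open>edge_unique\<close> propagates
  equality along each edge. The version for finite prefixes is the one that applies to
  cylinders.\<close>

lemma inf_paths_lift_unique:
  assumes "\<sigma> \<in> inf_paths M s0" "\<tau> \<in> inf_paths M s0" "\<forall>i\<le>n. \<phi> (\<sigma> i) = \<phi> (\<tau> i)" "i \<le> n"
  shows "\<sigma> i = \<tau> i"
  using \<open>i \<le> n\<close>
proof (induction i)
  case 0
  then show ?case using assms by (simp add: inf_paths_def)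
next
  case (Suc i)
  then have eq: "\<sigma> i = \<tau> i" by simp
  have "is_edge M (\<sigma> i) (\<sigma> (Suc i))" "is_edge M (\<tau> i) (\<tau> (Suc i))"
    using assms(1,2) by (auto simp: inf_paths_def)
  then have "is_edge M (\<sigma> i) (\<sigma> (Suc i))" "is_edge M (\<sigma> i) (\<tau> (Suc i))"
    unfolding eq by simp_all
  moreover have "\<phi> (\<sigma> (Suc i)) = \<phi> (\<tau> (Suc i))"
    using assms(3) Suc.prems by blast
  ultimately show ?case
    by (rule edge_unique[OF inf_paths_reachable[OF assms(1)]])
qed

lemma weight_diverges_image:
  assumes "\<sigma> \<in> inf_paths M s0"
  shows "weight_diverges N (\<phi> \<circ> \<sigma>) \<longleftrightarrow> weight_diverges M \<sigma>"
proof -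
  have "weight N (\<phi> (\<sigma> i)) (\<phi> (\<sigma> (Suc i))) = weight M (\<sigma> i) (\<sigma> (Suc i))" for i
    using edge[OF inf_paths_reachable[OF assms]] assms by (simp add: inf_paths_def)
  then show ?thesis by (simp add: weight_diverges_def)
qed

lemma absolutely_convergent_covering:
  "absolutely_convergent M s0 \<longleftrightarrow> absolutely_convergent N (\<phi> s0)"
  unfolding absolutely_convergent_def
  by (metis inf_paths_image inf_paths_lift weight_diverges_image)

section \<open>Pushforward of the path measure\<close>

lemma measurable_path_map:
  "(\<lambda>\<sigma>. \<phi> \<circ> \<sigma>) \<in> measurable (path_measure M s0) (Pi\<^sub>M UNIV (\<lambda>_. count_space UNIV))"
proof -
  have "(\<lambda>\<sigma>. \<lambda>i\<in>UNIV. \<phi> (\<sigma> i)) \<in>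
      measurable (path_measure M s0) (Pi\<^sub>M UNIV (\<lambda>_. count_space UNIV))"
    by (intro measurable_restrict measurable_compose[OF measurable_path_component[OF sets_path_measure]]) simp
  then show ?thesis by (simp add: comp_def restrict_def)
qed

text \<open>Both measures live on paths in the countable reachable part of \<open>N\<close>, so
  comparing cylinders suffices.\<close>

lemma path_measure_covering:
  "distr (path_measure M s0) (Pi\<^sub>M UNIV (\<lambda>_. count_space UNIV)) (\<lambda>\<sigma>. \<phi> \<circ> \<sigma>) =
    path_measure N (\<phi> s0)"
    (is "?D = ?Q")
proof (rule measure_eqI_cylinder)
  let ?P = "path_measure M s0"
  note M = AE_inf_paths[OF wdtmc] and N = AE_inf_paths[OF wdtmc_from_covering]
  interpret P: prob_space ?P
    by (rule prob_space_path_measure)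
  show "sets ?D = sets (Pi\<^sub>M UNIV (\<lambda>_. count_space UNIV))"
    by simp
  show sQ: "sets ?Q = sets (Pi\<^sub>M UNIV (\<lambda>_. count_space UNIV))"
    by (rule sets_path_measure)
  show "finite_measure ?D"
    by (intro P.finite_measure_distr measurable_path_map)
  show "countable (reachable N (\<phi> s0))"
    by (rule countable_reachable[OF wdtmc_from_covering])
  show "AE u in ?Q. \<forall>i. u i \<in> reachable N (\<phi> s0)"
    using N by eventually_elim (rule allI, rule inf_paths_reachable)
  have ae: "AE \<sigma> in ?P. \<forall>i. (\<phi> \<circ> \<sigma>) i \<in> reachable N (\<phi> s0)"
    using M by eventually_elim (rule allI, rule inf_paths_reachable[OF inf_paths_image])
  note [measurable] = pred_path_component[OF refl]
  have "{u \<in> space (Pi\<^sub>M UNIV (\<lambda>_. count_space UNIV)). \<forall>i::nat. u i \<in> reachable N (\<phi> s0)}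
      \<in> sets (Pi\<^sub>M UNIV (\<lambda>_. count_space UNIV))"
    by measurable
  from ae AE_distr_iff[OF measurable_path_map this]
  show "AE u in ?D. \<forall>i. u i \<in> reachable N (\<phi> s0)"
    by simp
  fix n :: nat and u :: "nat \<Rightarrow> 'b"
  let ?C = "{v. \<forall>i\<le>n. v i = u i}"
  have pre: "{\<sigma>. \<forall>i\<le>n. \<phi> (\<sigma> i) = u i} \<in> sets ?P"
    using measurable_sets[OF measurable_path_map sets_cylinder[OF refl, of n u]]
    by (simp add: space_path_measure vimage_def)
  have D: "emeasure ?D ?C = emeasure ?P {\<sigma>. \<forall>i\<le>n. \<phi> (\<sigma> i) = u i}"
    by (subst emeasure_distr[OF measurable_path_map sets_cylinder[OF refl]])
       (simp add: space_path_measure vimage_def)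
  show "emeasure ?D ?C = emeasure ?Q ?C"
  \<comment> \<open>Either the prefix \<open>u\<close> lifts to a path \<tau>, and unique lifting
    makes the preimage of the cylinder almost surely the single cylinder of \<tau>, with the same
    product of probabilities; or no path lifts it, and both measures vanish.\<close>
  proof (cases "\<exists>\<tau>\<in>inf_paths M s0. \<forall>i\<le>n. \<phi> (\<tau> i) = u i")
    case True
    then obtain \<tau> where \<tau>: "\<tau> \<in> inf_paths M s0" "\<forall>i\<le>n. \<phi> (\<tau> i) = u i" by blast
    have "AE \<sigma> in ?P. (\<forall>i\<le>n. \<phi> (\<sigma> i) = u i) \<longleftrightarrow> (\<forall>i\<le>n. \<sigma> i = \<tau> i)"
      using M
    proof eventually_elim
      case (elim \<sigma>)
      then show ?case
        using \<tau> inf_paths_lift_unique[OF elim \<tau>(1), of n] by auto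
    qed
    then have "emeasure ?D ?C = emeasure ?P {\<sigma>. \<forall>i\<le>n. \<sigma> i = \<tau> i}"
      unfolding D by (intro emeasure_eq_AE pre sets_cylinder sets_path_measure) auto
    also have "\<dots> = (\<Prod>i<n. pmf (next_pmf M (\<tau> i)) (\<tau> (Suc i)))"
      using \<tau> by (simp add: emeasure_path_measure_cylinder inf_paths_def)
    also have "(\<Prod>i<n. pmf (next_pmf M (\<tau> i)) (\<tau> (Suc i))) =
        (\<Prod>i<n. pmf (next_pmf N (\<phi> (\<tau> i))) (\<phi> (\<tau> (Suc i))))"
    proof (intro prod.cong refl)
      fix i
      have "\<tau> i \<in> reachable M s0" "\<phi> (\<tau> i) \<in> reachable N (\<phi> s0)" "is_edge M (\<tau> i) (\<tau> (Suc i))"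
        using \<tau>(1) inf_paths_reachable[OF \<tau>(1)] inf_paths_reachable[OF inf_paths_image[OF \<tau>(1)]]
        by (auto simp: inf_paths_def)
      then show "pmf (next_pmf M (\<tau> i)) (\<tau> (Suc i)) = pmf (next_pmf N (\<phi> (\<tau> i))) (\<phi> (\<tau> (Suc i)))"
        using edge wdtmc wdtmc_from_covering by (simp add: pmf_next_pmf wdtmc_from_is_dist)
    qed
    also have "ennreal \<dots> = emeasure ?Q ?C"
    proof -
      have "u 0 = \<phi> s0"
        using \<tau> by (auto simp: inf_paths_def)
      then show ?thesis
        using \<tau> by (simp add: emeasure_path_measure_cylinder)
    qed
    finally show ?thesis .
  next
    case False
    have "AE \<sigma> in ?P. \<sigma> \<notin> {\<sigma>. \<forall>i\<le>n. \<phi> (\<sigma> i) = u i}"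
      using M by eventually_elim (use False in auto)
    then have "emeasure ?D ?C = 0"
      unfolding D AE_iff_null_sets[OF pre, symmetric] by (rule null_setsD1)
    \<comment> \<open>A path of \<open>N\<close> in this cylinder would lift to a path of
      \<open>M\<close>, contrary to the case assumption.\<close>
    moreover have "AE v in ?Q. v \<notin> ?C"
      using N
    proof eventually_elim
      case (elim v)
      then show ?case
        using False by (auto elim!: inf_paths_lift)
    qed
    then have "emeasure ?Q ?C = 0"
      unfolding AE_iff_null_sets[OF sets_cylinder[OF sQ], symmetric] by (rule null_setsD1)
    ultimately show ?thesis by simp
  qed
qed

text \<open>Divergence in \<open>N\<close> is an event for the pushforward measure, and its preimage
  agrees with divergence in \<open>M\<close> on almost every path.\<close>

lemma almost_surely_convergent_covering:
  "almost_surely_convergent M s0 \<longleftrightarrow> almost_surely_convergent N (\<phi> s0)"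
proof -
  let ?P = "path_measure M s0" and ?Q = "path_measure N (\<phi> s0)"
  let ?B = "{u \<in> inf_paths N (\<phi> s0). weight_diverges N u}"
  interpret Q: prob_space ?Q
    by (rule prob_space_path_measure)
  have "?B \<in> sets (Pi\<^sub>M UNIV (\<lambda>_. count_space UNIV))"
    using sets_weight_diverges[OF wdtmc_from_covering] by (simp add: sets_path_measure)
  then have "(AE u in ?Q. u \<in> ?B) \<longleftrightarrow> (AE \<sigma> in ?P. \<phi> \<circ> \<sigma> \<in> ?B)"
    unfolding path_measure_covering[symmetric]
    by (intro AE_distr_iff measurable_path_map) (simp add: space_PiM)
  also have "\<dots> \<longleftrightarrow> (AE \<sigma> in ?P. weight_diverges M \<sigma>)"
    by (rule eventually_cong[OF AE_inf_paths[OF wdtmc]])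
       (use inf_paths_image weight_diverges_image in auto)
  also have "\<dots> \<longleftrightarrow> almost_surely_convergent M s0"
    by (simp add: almost_surely_convergent_iff_AE wdtmc)
  finally show ?thesis
    unfolding almost_surely_convergent_def[of N]
    by (simp add: Q.prob_eq_1 sets_weight_diverges wdtmc_from_covering)
qed

end

section \<open>Positive scaling of planar systems\<close>

text \<open>In a planar system this is the facet through a nonzero \<open>x\<close> whenever there
  is one, so \<open>map_prod id ray\<close> is the quotient map.\<close>

definition ray :: "'a::real_vector \<Rightarrow> 'a set" where
  "ray x = {t *\<^sub>R x | t. 0 \<le> t}"

lemma ray_self: "x \<in> ray x"
  unfolding ray_def by (auto intro!: exI[of _ 1])

lemma is_ray_eq_ray:
  assumes "is_ray f" "x \<in> f" "x \<noteq> 0"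
  shows "f = ray x"
proof -
  obtain d where f: "f = {t *\<^sub>R d | t. 0 \<le> t}"
    using assms(1) by (auto simp: is_ray_def)
  obtain t where t: "x = t *\<^sub>R d" "0 < t"
    using assms(2,3) by (force simp: f)
  show ?thesis
    unfolding f ray_def
  proof (intro equalityI subsetI)
    fix y assume "y \<in> {t *\<^sub>R d | t. 0 \<le> t}"
    then obtain u where "y = u *\<^sub>R d" "0 \<le> u" by blast
    then have "y = (u / t) *\<^sub>R x" "0 \<le> u / t"
      using t by auto
    then show "y \<in> {t *\<^sub>R x | t. 0 \<le> t}" by blast
  next
    fix y assume "y \<in> {t *\<^sub>R x | t. 0 \<le> t}"
    then obtain u where "y = u *\<^sub>R x" "0 \<le> u" by blast
    then have "y = (u * t) *\<^sub>R d" "0 \<le> u * t"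
      using t by auto
    then show "y \<in> {t *\<^sub>R d | t. 0 \<le> t}" by blast
  qed
qed

lemma is_ray_scaleR: "is_ray f \<Longrightarrow> x \<in> f \<Longrightarrow> 0 \<le> a \<Longrightarrow> a *\<^sub>R x \<in> f"
  by (force simp: is_ray_def)

lemma pos_scaling_invariant_iff:
  assumes "pos_scaling_invariant A" "0 < a"
  shows "a *\<^sub>R x \<in> A \<longleftrightarrow> x \<in> A"
proof
  assume "a *\<^sub>R x \<in> A"
  then have "inverse a *\<^sub>R a *\<^sub>R x \<in> A"
    using assms unfolding pos_scaling_invariant_def by (meson positive_imp_inverse_positive)
  then show "x \<in> A" using assms(2) by simp
qed (use assms in \<open>auto simp: pos_scaling_invariant_def\<close>)

text \<open>Multiplication by \<open>a > 0\<close> is an injective linear map of the space onto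
  itself that carries \<open>A\<close> onto \<open>A\<close>, so it preserves the closure, the
  interior and hence the frontier.\<close>

lemma pos_scaling_invariant_frontier:
  assumes "pos_scaling_invariant A"
  shows "pos_scaling_invariant (frontier A)"
  unfolding pos_scaling_invariant_def
proof (intro ballI allI impI)
  fix x and a :: real assume x: "x \<in> frontier A" and a: "0 < a"
  have im: "(\<lambda>x. a *\<^sub>R x) ` A = A"
  proof (intro equalityI subsetI)
    fix y assume "y \<in> A"
    moreover have y: "y = a *\<^sub>R (inverse a *\<^sub>R y)"
      using a by simp
    ultimately have "inverse a *\<^sub>R y \<in> A"
      using pos_scaling_invariant_iff[OF assms a, of "inverse a *\<^sub>R y"] by simp
    with y show "y \<in> (\<lambda>x. a *\<^sub>R x) ` A" by blast
  qed (use a pos_scaling_invariant_iff[OF assms a] in auto)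
  have inj: "inj (\<lambda>x::real^_. a *\<^sub>R x)"
    using a by (auto simp: inj_on_def)
  have "closure A = (\<lambda>x. a *\<^sub>R x) ` closure A"
    using closure_scaleR[of a A] by (simp add: im)
  moreover have "interior A = (\<lambda>x. a *\<^sub>R x) ` interior A"
    using interior_injective_linear_image[OF linear_scaleR inj, of A] by (simp add: im)
  ultimately have "frontier A = (\<lambda>x. a *\<^sub>R x) ` frontier A"
    unfolding frontier_def image_set_diff[OF inj] by simp
  with x show "a *\<^sub>R x \<in> frontier A" by blast
qed

lemma cont_transition_unique:
  assumes "cont_transition H q x y" "cont_transition H q x z"
  shows "y = z"
proof -
  obtain S where S: "0 < S" "y = x + S *\<^sub>R Flow H q" "y \<in> frontier (Inv H q)"
    "\<And>t. 0 < t \<Longrightarrow> t < S \<Longrightarrow> x + t *\<^sub>R Flow H q \<notin> frontier (Inv H q)"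
    using assms(1) by (auto simp: cont_transition_def)
  obtain T where T: "0 < T" "z = x + T *\<^sub>R Flow H q" "z \<in> frontier (Inv H q)"
    "\<And>t. 0 < t \<Longrightarrow> t < T \<Longrightarrow> x + t *\<^sub>R Flow H q \<notin> frontier (Inv H q)"
    using assms(2) by (auto simp: cont_transition_def)
  \<comment> \<open>Both are the first positive time at which the flow line meets the frontier; a
    smaller one would contradict the minimality of the other.\<close>
  have "S = T"
    using S T by (metis linorder_neqE_linordered_idom)
  then show ?thesis using S T by simp
qed

text \<open>The flow vector stays fixed when points are scaled, so time scales instead: the scaled
  trajectory at time \<open>t\<close> is \<open>a\<close> times the original one at time
  \<open>t / a\<close>, and the hitting time \<open>T\<close> becomes \<open>a * T\<close>.\<close>

lemma cont_transition_scaleR: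
  assumes inv: "pos_scaling_invariant (Inv H q)" and a: "0 < a" and c: "cont_transition H q x y"
  shows "cont_transition H q (a *\<^sub>R x) (a *\<^sub>R y)"
proof -
  note fr = pos_scaling_invariant_frontier[OF inv]
  obtain T where T: "0 < T" "y = x + T *\<^sub>R Flow H q" "y \<in> frontier (Inv H q)"
    "\<And>t. 0 < t \<Longrightarrow> t < T \<Longrightarrow> x + t *\<^sub>R Flow H q \<notin> frontier (Inv H q)"
    using c by (auto simp: cont_transition_def)
  have "a *\<^sub>R x + t *\<^sub>R Flow H q \<notin> frontier (Inv H q)" if "0 < t" "t < a * T" for t
  proof -
    have "a *\<^sub>R x + t *\<^sub>R Flow H q = a *\<^sub>R (x + (t / a) *\<^sub>R Flow H q)"
      using a by (simp add: scaleR_add_right)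
    moreover have "0 < t / a" "t / a < T"
      using a that by (auto simp: field_simps)
    ultimately show ?thesis
      using T(4) pos_scaling_invariant_iff[OF fr a] by metis
  qed
  moreover have "a *\<^sub>R y = a *\<^sub>R x + (a * T) *\<^sub>R Flow H q"
    by (simp add: T scaleR_add_right)
  moreover have "a *\<^sub>R y \<in> frontier (Inv H q)" "0 < a * T"
    using T a pos_scaling_invariant_iff[OF fr a] by auto
  ultimately show ?thesis
    using c pos_scaling_invariant_iff[OF inv a] unfolding cont_transition_def by blast
qed

lemma infinite_edge_scaleR:
  assumes inv: "pos_scaling_invariant (Inv H q)" and a: "0 < a" and c: "infinite_edge H q x"
  shows "infinite_edge H q (a *\<^sub>R x)"
  unfolding infinite_edge_def
proof (intro allI impI)
  fix t :: real assume "0 \<le> t"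
  then have "x + (t / a) *\<^sub>R Flow H q \<in> Inv H q"
    using c a by (simp add: infinite_edge_def)
  moreover have "a *\<^sub>R x + t *\<^sub>R Flow H q = a *\<^sub>R (x + (t / a) *\<^sub>R Flow H q)"
    using a by (simp add: scaleR_add_right)
  ultimately show "a *\<^sub>R x + t *\<^sub>R Flow H q \<in> Inv H q"
    using pos_scaling_invariant_iff[OF inv a] by metis
qed

section \<open>Positive edges of the semantics\<close>

lemma tprob_semantics_pos_cases:
  assumes "0 < tprob (semantics H) s s'"
  obtains (infinite) "infinite_edge H (fst s) (snd s)" "s' = s"
  | (jump) p where "\<not> infinite_edge H (fst s) (snd s)" "jump H s s' p"
  using assms by (auto simp: semantics_def split: if_splits)

lemma infinite_edge_target:
  "infinite_edge H (fst s) (snd s) \<Longrightarrow> 0 < tprob (semantics H) s s' \<Longrightarrow> s' = s"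
  by (simp add: semantics_def split: if_splits)

text \<open>The flow is deterministic and only the new location is random, so all successors of a
  state share one continuous component. This makes lifts unique and quotient values independent of
  representatives.\<close>

lemma tprob_semantics_target_unique:
  assumes "0 < tprob (semantics H) s s'" "0 < tprob (semantics H) s s''"
  shows "snd s' = snd s''"
  using assms(1)
proof (cases rule: tprob_semantics_pos_cases)
  case infinite
  with assms(2) show ?thesis
    by (auto elim: tprob_semantics_pos_cases)
next
  case (jump p)
  from assms(2) show ?thesis
  proof (cases rule: tprob_semantics_pos_cases)
    case (jump p')
    with \<open>jump H s s' p\<close> show ?thesis
      by (auto simp: jump_def intro: cont_transition_unique)
  qed (use jump in simp)
qed

text \<open>
  Every infinite edge has weight \<open>\<infinity>\<close> and is a self-loop at a nonzero point; along all other edges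
  the weights telescope.
\<close>

lemma weight_diverges_semantics:
  assumes wd: "semantics_well_defined H s0" and \<sigma>: "\<sigma> \<in> inf_paths (semantics H) s0"
  shows "weight_diverges (semantics H) \<sigma> \<longleftrightarrow> converges_to_0 \<sigma>"
proof -
  let ?w = "\<lambda>i. weight (semantics H) (\<sigma> i) (\<sigma> (Suc i))"
  let ?n = "\<lambda>i. infnorm (snd (\<sigma> i))"
  have edge: "0 < tprob (semantics H) (\<sigma> i) (\<sigma> (Suc i))" for i
    using \<sigma> by (simp add: inf_paths_def is_edge_def)
  have pos: "0 < ?n i" for i
    using wd inf_paths_reachable[OF \<sigma>, of i] by (simp add: semantics_well_defined_def infnorm_pos_lt)
  show ?thesis
  proof (cases "\<exists>k. infinite_edge H (fst (\<sigma> k)) (snd (\<sigma> k))")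
    case True
    then obtain k where k: "infinite_edge H (fst (\<sigma> k)) (snd (\<sigma> k))" by blast
    have const: "\<sigma> n = \<sigma> k" if "k \<le> n" for n
      using that
    proof (induction n rule: dec_induct)
      case (step n)
      then show ?case
        using infinite_edge_target[OF _ edge[of n]] k by simp
    qed simp
    have "\<not> converges_to_0 \<sigma>"
    proof
      assume "converges_to_0 \<sigma>"
      then have "?n \<longlonglongrightarrow> 0"
        by (simp only: converges_to_0_def)
      moreover have "?n \<longlonglongrightarrow> ?n k"
        by (rule tendsto_eventually) (use const in \<open>metis (mono_tags, lifting) eventually_sequentially\<close>)
      ultimately have "?n k = 0"
        by (rule LIMSEQ_unique[symmetric])
      then show False
        using pos[of k] by simp
    qed
    moreover have "\<not> weight_diverges (semantics H) \<sigma>"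
    proof
      assume "weight_diverges (semantics H) \<sigma>"
      then have "\<forall>\<^sub>F n in sequentially. (\<Sum>i<n. ?w i) < ereal 0"
        unfolding weight_diverges_def tendsto_MInfty by blast
      then obtain N where "\<And>n. N \<le> n \<Longrightarrow> (\<Sum>i<n. ?w i) < ereal 0"
        by (auto simp: eventually_sequentially)
      \<comment> \<open>This number of terms lies past the threshold \<open>N\<close> and also
        includes the term with index \<open>k\<close>. In \<open>ereal\<close>, \<infinity> absorbs
        every summand, even \<open>-\<infinity>\<close>, so that term makes the whole sum
        \<infinity>.\<close>
      then have "(\<Sum>i<max N (Suc k). ?w i) < ereal 0"
        by simp
      moreover have "?w k = \<infinity>"
        using k const[of "Suc k"] by (simp add: semantics_def)
      then have "(\<Sum>i<max N (Suc k). ?w i) = \<infinity>"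
        by (auto simp: sum_Pinfty)
      ultimately show False by simp
    qed
    ultimately show ?thesis by simp
  next
    case False
    have w: "?w i = ereal (ln (?n (Suc i)) - ln (?n i))" for i
      using edge[of i]
    proof (cases rule: tprob_semantics_pos_cases)
      case (jump p)
      then have "?w i = ereal (ln (?n (Suc i) / ?n i))"
        by (auto simp: semantics_def)
      then show ?thesis
        using pos[of i] pos[of "Suc i"] by (simp add: ln_div)
    qed (use False in auto)
    have "(\<Sum>i<n. ?w i) = ereal (ln (?n n) - ln (?n 0))" for n
      by (induction n) (simp_all add: w flip: zero_ereal_def)
    then have "weight_diverges (semantics H) \<sigma> \<longleftrightarrow>
        filterlim (\<lambda>n. ln (?n n) - ln (?n 0)) at_bot sequentially"
      by (simp add: weight_diverges_def tendsto_MInfty filterlim_at_bot_dense)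
    also have "\<dots> \<longleftrightarrow> converges_to_0 \<sigma>"
    proof
      assume "filterlim (\<lambda>n. ln (?n n) - ln (?n 0)) at_bot sequentially"
      then have "(\<lambda>n. exp (ln (?n n) - ln (?n 0))) \<longlonglongrightarrow> 0"
        by (rule filterlim_compose[OF exp_at_bot])
      \<comment> \<open>Exponentiating the telescoped sum and multiplying by the initial norm gives
        back the norm at time \<open>n\<close>.\<close>
      then have "(\<lambda>n. exp (ln (?n n) - ln (?n 0)) * ?n 0) \<longlonglongrightarrow> 0 * ?n 0"
        by (intro tendsto_mult_right)
      then show "converges_to_0 \<sigma>"
        using pos[of 0] pos by (simp add: converges_to_0_def exp_diff)
    next
      assume "converges_to_0 \<sigma>"
      \<comment> \<open>The norms are strictly positive, so they approach 0 from the right, where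
        \<open>ln\<close> tends to \<open>-\<infinity>\<close>.\<close>
      then have "filterlim ?n (at_right 0) sequentially"
        using pos by (simp add: converges_to_0_def filterlim_at less_imp_neq[THEN not_sym])
      then have "filterlim (\<lambda>n. ln (?n n)) at_bot sequentially"
        by (rule filterlim_compose[OF ln_at_0])
      then show "filterlim (\<lambda>n. ln (?n n) - ln (?n 0)) at_bot sequentially"
        using filterlim_tendsto_add_at_bot_iff[OF tendsto_const, of "- ln (?n 0)" _ sequentially] by simp
    qed
    finally show ?thesis .
  qed
qed

section \<open>The quotient of a planar system\<close>

context
  fixes H :: "('q::finite, 2) ppcd"
  assumes planar: "planar_ppcd H"
begin

lemma pos_scaling_invariant_Inv: "pos_scaling_invariant (Inv H q)"
  using planar by (simp add: planar_ppcd_def ppcd_def)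

lemma is_ray_facet: "f \<in> all_facets H \<Longrightarrow> is_ray f"
  using planar by (simp add: planar_ppcd_def)

text \<open>The facet that is hit is a ray, so it contains the scaled target as well, and the same
  facet and distribution witness the scaled jump. As an equality of predicates in \<open>p\<close>,
  this also preserves the definite description in \<open>semantics\<close>.\<close>

lemma jump_scaleR:
  assumes a: "0 < a"
  shows "jump H (q, a *\<^sub>R x) (q', a *\<^sub>R x') = jump H (q, x) (q', x')"
proof -
  have *: "jump H (q, b *\<^sub>R y) (q', b *\<^sub>R y') p" if "0 < b" "jump H (q, y) (q', y') p" for b y y' p
  proof -
    from that(2) obtain \<rho> f where "cont_transition H q y y'" "disc_transition H q q' p \<rho> f" "y' \<in> f"
      by (auto simp: jump_def)
    moreover from this have "is_ray f"
      by (intro is_ray_facet) (auto simp: all_facets_def disc_transition_def)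
    ultimately show ?thesis
      using \<open>0 < b\<close> cont_transition_scaleR[OF pos_scaling_invariant_Inv] is_ray_scaleR[of f y' b]
      by (auto simp: jump_def)
  qed
  show ?thesis
    using *[OF a, of x x'] *[of "inverse a" "a *\<^sub>R x" "a *\<^sub>R x'"] a by (auto simp: fun_eq_iff)
qed

lemma infinite_edge_scaleR_iff:
  assumes a: "0 < a"
  shows "infinite_edge H q (a *\<^sub>R x) \<longleftrightarrow> infinite_edge H q x"
  using infinite_edge_scaleR[OF pos_scaling_invariant_Inv a, of q x] a
    infinite_edge_scaleR[OF pos_scaling_invariant_Inv, of "inverse a" q "a *\<^sub>R x"]
  by auto

lemma tprob_semantics_scaleR:
  assumes "0 < a"
  shows "tprob (semantics H) (q, a *\<^sub>R x) (q', a *\<^sub>R x') = tprob (semantics H) (q, x) (q', x')"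
  using assms by (auto simp: semantics_def jump_scaleR infinite_edge_scaleR_iff)

lemma weight_semantics_scaleR:
  assumes "0 < a"
  shows "weight (semantics H) (q, a *\<^sub>R x) (q', a *\<^sub>R x') = weight (semantics H) (q, x) (q', x')"
  using assms by (auto simp: semantics_def jump_scaleR infinite_edge_scaleR_iff infnorm_mul)

section \<open>Independence of the quotient from representatives\<close>

lemma facet_scaleE:
  assumes "f \<in> all_facets H" "x \<in> f" "y \<in> f" "x \<noteq> 0" "y \<noteq> 0"
  obtains a where "0 < a" "y = a *\<^sub>R x"
proof -
  have "y \<in> ray x"
    using assms is_ray_eq_ray[OF is_ray_facet] by blast
  then obtain a where "y = a *\<^sub>R x" "0 \<le> a"
    by (auto simp: ray_def)
  with assms that show ?thesis
    by (cases "a = 0") auto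
qed

text \<open>The two sources lie on one ray and differ by a factor \<open>a\<close>. Scaled back by
  \<open>a\<close>, the second target becomes a successor point of the first source, so determinism
  of the flow identifies it with \<open>x'\<close>.\<close>

lemma represents_unique:
  assumes x: "represents H u v x x'" and y: "represents H u v y y'"
  obtains a where "0 < a" "y = a *\<^sub>R x" "y' = a *\<^sub>R x'"
proof -
  obtain a where a: "0 < a" "y = a *\<^sub>R x"
    using x y by (auto simp: represents_def elim: facet_scaleE)
  have "y' = a *\<^sub>R (inverse a *\<^sub>R y')"
    using a by simp
  then have "0 < tprob (semantics H) (fst u, x) (fst v, inverse a *\<^sub>R y')"
    using y a(2) tprob_semantics_scaleR[OF a(1), of "fst u" x "fst v" "inverse a *\<^sub>R y'"]
    by (simp add: represents_def)
  then have "x' = inverse a *\<^sub>R y'"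
    using tprob_semantics_target_unique[of H "(fst u, x)" "(fst v, x')"] x
    by (fastforce simp: represents_def)
  then have "y' = a *\<^sub>R x'"
    using a by simp
  with a that show ?thesis by blast
qed

lemma ppcd_quotient_represents:
  assumes x: "represents H u v x x'"
  shows "tprob (ppcd_quotient H) u v = tprob (semantics H) (fst u, x) (fst v, x')"
    and "weight (ppcd_quotient H) u v = weight (semantics H) (fst u, x) (fst v, x')"
proof -
  have "tprob (semantics H) (fst u, y) (fst v, y') = tprob (semantics H) (fst u, x) (fst v, x') \<and>
      weight (semantics H) (fst u, y) (fst v, y') = weight (semantics H) (fst u, x) (fst v, x')"
    if "represents H u v y y'" for y y'
    using represents_unique[OF x that] by (metis tprob_semantics_scaleR weight_semantics_scaleR)
  then have
    "(THE p. \<exists>x1 x2. represents H u v x1 x2 \<and> p = tprob (semantics H) (fst u, x1) (fst v, x2)) =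
      tprob (semantics H) (fst u, x) (fst v, x')"
    "(THE w. \<exists>x1 x2. represents H u v x1 x2 \<and> w = weight (semantics H) (fst u, x1) (fst v, x2)) =
      weight (semantics H) (fst u, x) (fst v, x')"
    using x by (blast intro!: the_equality)+
  with x show "tprob (ppcd_quotient H) u v = tprob (semantics H) (fst u, x) (fst v, x')"
    "weight (ppcd_quotient H) u v = weight (semantics H) (fst u, x) (fst v, x')"
    unfolding ppcd_quotient_def by auto
qed

lemma wdtmc_covering_quotient:
  assumes wd: "semantics_well_defined H (q0, x0)" and f0: "f0 \<in> all_facets H" "x0 \<in> f0"
  shows "wdtmc_covering (semantics H) (ppcd_quotient H) (q0, x0) (map_prod id ray)"
proof -
  let ?S = "semantics H" and ?N = "ppcd_quotient H"
  let ?\<phi> = "map_prod id ray :: 'q \<times> (real^2) \<Rightarrow> 'q \<times> (real^2) set"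
  let ?R = "reachable ?S (q0, x0)"
  have nz: "snd s \<noteq> 0" if "s \<in> ?R" for s
    using wd that by (simp add: semantics_well_defined_def)
  \<comment> \<open>The start lies on \<open>f0\<close>, a jump lands on a facet, and an infinite
    edge does not move, so reachable states map into the states of the quotient.\<close>
  have facet: "ray (snd s) \<in> all_facets H" if "s \<in> ?R" for s
  proof -
    from that have "(is_edge ?S)\<^sup>*\<^sup>* (q0, x0) s"
      by (simp add: reachable_def)
    then show ?thesis
    proof (induction rule: rtranclp_induct)
      case base
      have "f0 = ray x0"
        using f0 nz[OF reachable_refl] is_ray_facet by (intro is_ray_eq_ray) auto
      then show ?case using f0 by simp
    next
      case (step s s')
      have s': "s' \<in> ?R"
        using step by (simp add: reachable_def)
      from step have "0 < tprob ?S s s'"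
        by (simp add: is_edge_def)
      then show ?case
      proof (cases rule: tprob_semantics_pos_cases)
        case infinite
        then show ?thesis using step by simp
      next
        case (jump p)
        then obtain f where f: "f \<in> all_facets H" "snd s' \<in> f"
          by (auto simp: jump_def disc_transition_def all_facets_def)
        with is_ray_eq_ray[OF is_ray_facet, of f "snd s'"] nz[OF s'] show ?thesis
          by simp
      qed
    qed
  qed
  \<comment> \<open>The endpoints of any edge out of a reachable state are themselves
    representatives, so the quotient values can be read off from it.\<close>
  have edge: "represents H (?\<phi> s) (?\<phi> s') (snd s) (snd s')" if "s \<in> ?R" "is_edge ?S s s'" for s s'
    using facet nz that reachable_step[OF that]
    by (simp add: represents_def ray_self is_edge_def)
  show ?thesis
  proof
    show "wdtmc_from ?S (q0, x0)"
      using wd by (simp add: semantics_well_defined_def)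
    show "?\<phi> (q0, x0) \<in> states ?N"
      using facet[OF reachable_refl] by (simp add: ppcd_quotient_def)
    fix s assume s: "s \<in> ?R"
    {
      fix s' assume s': "is_edge ?S s s'"
      have "states ?N = UNIV \<times> all_facets H"
        by (simp add: ppcd_quotient_def)
      then show "is_edge ?N (?\<phi> s) (?\<phi> s') \<and> tprob ?N (?\<phi> s) (?\<phi> s') = tprob ?S s s' \<and>
          weight ?N (?\<phi> s) (?\<phi> s') = weight ?S s s'"
        using ppcd_quotient_represents[OF edge[OF s s']] s' facet s reachable_step[OF s s']
        by (simp add: is_edge_def mem_Times_iff)
      \<comment> \<open>Equal images give equal locations, and determinism of the flow gives equal
        points.\<close>
      fix s'' assume "is_edge ?S s s''" "?\<phi> s' = ?\<phi> s''"
      then show "s' = s''"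
        using s' tprob_semantics_target_unique[of H s s' s'']
        by (simp add: is_edge_def prod_eq_iff)
    }
    \<comment> \<open>A nonzero quotient value comes from some representing pair. Its source lies on
      the ray of \<open>snd s\<close>, so a factor \<open>a\<close> moves it to
      \<open>snd s\<close>, and scaling its target by the same factor gives the lifted edge.\<close>
    fix u assume "tprob ?N (?\<phi> s) u \<noteq> 0"
    then obtain x x' where x: "represents H (?\<phi> s) u x x'"
      by (auto simp: ppcd_quotient_def split: if_splits)
    then obtain a where a: "0 < a" "snd s = a *\<^sub>R x"
      using nz[OF s] facet_scaleE[of "ray (snd s)" x "snd s"] ray_self
      by (auto simp: represents_def)
    have u: "is_ray (snd u)" "x' \<in> snd u" "x' \<noteq> 0"
      using x is_ray_facet by (auto simp: represents_def)
    then have "snd u = ray (a *\<^sub>R x')"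
      using a by (intro is_ray_eq_ray is_ray_scaleR) auto
    moreover have "is_edge ?S s (fst u, a *\<^sub>R x')"
      using x a tprob_semantics_scaleR[OF a(1), of "fst s" x "fst u" x']
      by (cases s) (simp add: is_edge_def represents_def semantics_def[of H])
    ultimately show "\<exists>s'. is_edge ?S s s' \<and> ?\<phi> s' = u"
      by (intro exI[of _ "(fst u, a *\<^sub>R x')"]) (simp add: prod_eq_iff)
  qed
qed

end

theorem theorem5:
  fixes H :: "('q::finite, 2) ppcd" and q0 :: 'q and x0 :: "real^2" and f0 :: "(real^2) set"
  assumes "planar_ppcd H"
    and "semantics_well_defined H (q0, x0)"
    and "x0 \<noteq> 0"
    and "f0 \<in> all_facets H"
    and "x0 \<in> f0"
  shows "(absolutely_stable H (q0, x0) \<longleftrightarrow> absolutely_convergent (ppcd_quotient H) (q0, f0)) \<and>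
         (almost_surely_stable H (q0, x0) \<longleftrightarrow> almost_surely_convergent (ppcd_quotient H) (q0, f0))"
proof -
  interpret wdtmc_covering "semantics H" "ppcd_quotient H" "(q0, x0)" "map_prod id ray"
    using assms by (intro wdtmc_covering_quotient)
  \<comment> \<open>The nonzero point \<open>x0\<close> determines its facet, so the given start of
    the quotient is the image of \<open>(q0, x0)\<close>.\<close>
  have f0: "(q0, f0) = map_prod id ray (q0, x0)"
    using is_ray_eq_ray[OF is_ray_facet[OF assms(1,4)] assms(5,3)] by simp
  note diverges = weight_diverges_semantics[OF assms(2)]
  have "absolutely_stable H (q0, x0) \<longleftrightarrow> absolutely_convergent (semantics H) (q0, x0)"
    by (simp add: absolutely_stable_def absolutely_convergent_def diverges)
  moreover have "almost_surely_stable H (q0, x0) \<longleftrightarrow>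
      almost_surely_convergent (semantics H) (q0, x0)"
    \<comment> \<open>Convergence to 0 matches weight divergence only along infinite paths;
      \<open>conj_cong\<close> supplies path membership to the rewriting.\<close>
    unfolding almost_surely_stable_def almost_surely_convergent_def
    using diverges by (simp cong: conj_cong)
  ultimately show ?thesis
    unfolding f0 by (simp only: absolutely_convergent_covering almost_surely_convergent_covering)
qed

end
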